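(* Let $G$ be a connected (fork, dart)-free graph. If $G$ contains an induced claw with center $v$, then $G[M(v)]$ is perfect.
   Context: All graphs are finite and simple. For a vertex $v$, $N(v)$ is its neighbourhood and $M(v)=V(G)\setminus(N(v)\cup\{v\})$. The claw is $K_{1,3}$; a vertex $v$ is a center of a claw if $v$ has three pairwise nonadjacent neighbours. The fork is obtained from $K_{1,3}$ by subdividing one edge once. The dart is the graph on $v_1,\dots,v_5$ where $\{v_1,v_2,v_3,v_4\}$ induces a claw with center $v_1$ and $v_5$ is adjacent to $v_1,v_3,v_4$ but not to $v_2$. $G$ is $(H_1,H_2)$-free if it has no induced subgraph isomorphic to $H_1$ or $H_2$. A graph is perfect if every induced subgraph $H$ satisfies $\chi(H)=\omega(H)$. *)

theory Defs
  imports Main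
begin

definition simple_graph :: "'a set \<Rightarrow> ('a \<Rightarrow> 'a \<Rightarrow> bool) \<Rightarrow> bool" where
  "simple_graph V E \<longleftrightarrow> finite V \<and> (\<forall>x y. E x y \<longrightarrow> x \<in> V \<and> y \<in> V)
     \<and> (\<forall>x y. E x y \<longrightarrow> E y x) \<and> (\<forall>x. \<not> E x x)"

definition connected_graph :: "'a set \<Rightarrow> ('a \<Rightarrow> 'a \<Rightarrow> bool) \<Rightarrow> bool" where
  "connected_graph V E \<longleftrightarrow> V \<noteq> {} \<and> (\<forall>x\<in>V. \<forall>y\<in>V. (\<lambda>a b. E a b \<and> a \<in> V \<and> b \<in> V)\<^sup>*\<^sup>* x y)"

definition nbhd :: "'a set \<Rightarrow> ('a \<Rightarrow> 'a \<Rightarrow> bool) \<Rightarrow> 'a \<Rightarrow> 'a set" where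
  "nbhd V E v = {u \<in> V. E v u}"

definition nonnbhd :: "'a set \<Rightarrow> ('a \<Rightarrow> 'a \<Rightarrow> bool) \<Rightarrow> 'a \<Rightarrow> 'a set" where
  "nonnbhd V E v = V - (nbhd V E v \<union> {v})"

definition contains_induced :: "'a set \<Rightarrow> ('a \<Rightarrow> 'a \<Rightarrow> bool) \<Rightarrow> 'b set \<Rightarrow> ('b \<Rightarrow> 'b \<Rightarrow> bool) \<Rightarrow> bool" where
  "contains_induced V E VH EH \<longleftrightarrow>
     (\<exists>f. inj_on f VH \<and> f ` VH \<subseteq> V \<and> (\<forall>x\<in>VH. \<forall>y\<in>VH. E (f x) (f y) \<longleftrightarrow> EH x y))"

definition fork_edges :: "nat \<Rightarrow> nat \<Rightarrow> bool" where
  "fork_edges x y \<longleftrightarrow> {x, y} \<in> {{0,1}, {0,2}, {0,3}, {3,4}}"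

definition fork_verts :: "nat set" where "fork_verts = {0,1,2,3,4}"

definition dart_edges :: "nat \<Rightarrow> nat \<Rightarrow> bool" where
  "dart_edges x y \<longleftrightarrow> {x, y} \<in> {{1,2}, {1,3}, {1,4}, {5,1}, {5,3}, {5,4}}"

definition dart_verts :: "nat set" where "dart_verts = {1,2,3,4,5}"

definition claw_center :: "'a set \<Rightarrow> ('a \<Rightarrow> 'a \<Rightarrow> bool) \<Rightarrow> 'a \<Rightarrow> bool" where
  "claw_center V E v \<longleftrightarrow> v \<in> V \<and> (\<exists>a b c. a \<in> nbhd V E v \<and> b \<in> nbhd V E v \<and> c \<in> nbhd V E v
      \<and> a \<noteq> b \<and> a \<noteq> c \<and> b \<noteq> c \<and> \<not> E a b \<and> \<not> E a c \<and> \<not> E b c)"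

definition proper_colouring :: "('a \<Rightarrow> 'a \<Rightarrow> bool) \<Rightarrow> 'a set \<Rightarrow> nat \<Rightarrow> ('a \<Rightarrow> nat) \<Rightarrow> bool" where
  "proper_colouring E S k c \<longleftrightarrow> (\<forall>x\<in>S. c x < k) \<and> (\<forall>x\<in>S. \<forall>y\<in>S. E x y \<longrightarrow> c x \<noteq> c y)"

definition chromatic_number :: "('a \<Rightarrow> 'a \<Rightarrow> bool) \<Rightarrow> 'a set \<Rightarrow> nat" where
  "chromatic_number E S = (LEAST k. \<exists>c. proper_colouring E S k c)"

definition is_clique :: "('a \<Rightarrow> 'a \<Rightarrow> bool) \<Rightarrow> 'a set \<Rightarrow> bool" where
  "is_clique E K \<longleftrightarrow> (\<forall>x\<in>K. \<forall>y\<in>K. x \<noteq> y \<longrightarrow> E x y)"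

definition clique_number :: "('a \<Rightarrow> 'a \<Rightarrow> bool) \<Rightarrow> 'a set \<Rightarrow> nat" where
  "clique_number E S = Max (card ` {K. K \<subseteq> S \<and> is_clique E K})"

definition perfect_on :: "('a \<Rightarrow> 'a \<Rightarrow> bool) \<Rightarrow> 'a set \<Rightarrow> bool" where
  "perfect_on E S \<longleftrightarrow> (\<forall>T. T \<subseteq> S \<longrightarrow> chromatic_number E T = clique_number E T)"

end

theory Submission
  imports Defs
begin

text \<open>
  It suffices to colour every nonempty \<open>T \<subseteq> M(v)\<close> with \<open>\<omega>(T)\<close> colours, given such colourings of all
  \<open>T - u\<close>. Let \<open>A\<close> be the set of leaves of a claw with center \<open>v\<close>.

  Suppose some \<open>x \<in> N(v)\<close> has two nonadjacent neighbours in \<open>T\<close>. As \<open>G\<close> is dart-free,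
  \<open>N(x) \<inter> T\<close> is a disjoint union of at least two cliques, and as \<open>G\<close> is fork-free, every other
  vertex of \<open>T\<close> is complete or anticomplete to it. So a vertex in a smaller one of two of these cliques
  can reuse a colour of the larger one.

  Otherwise \<open>N(x) \<inter> T\<close> is a clique for every \<open>x \<in> N(v)\<close>. A vertex at distance 2 from \<open>v\<close> is adjacent
  to all of \<open>A\<close> but at most one leaf, so any two such vertices have a common neighbour in \<open>A\<close>, and
  those in \<open>T\<close> form a clique. As \<open>G\<close> is connected, the vertices further away all have distance 3;
  they induce a disjoint union of cliques, each complete or anticomplete to every vertex at
  distance 2. So \<open>T\<close> has a vertex whose neighbours in \<open>T\<close> form a clique, and \<open>\<omega>(T)\<close> colours
  leave one free for it.
\<close>

section \<open>Colourings and cliques\<close>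

definition colourable :: "('a \<Rightarrow> 'a \<Rightarrow> bool) \<Rightarrow> 'a set \<Rightarrow> nat \<Rightarrow> bool" where
  "colourable E T k \<longleftrightarrow> (\<exists>c. proper_colouring E T k c)"

definition closed_nbhd :: "'a set \<Rightarrow> ('a \<Rightarrow> 'a \<Rightarrow> bool) \<Rightarrow> 'a \<Rightarrow> 'a set" where
  "closed_nbhd T E u = insert u (nbhd T E u)"

lemma nbhd_subset: "nbhd T E u \<subseteq> T"
  unfolding nbhd_def by blast

lemma finite_nbhd: "finite T \<Longrightarrow> finite (nbhd T E u)"
  using finite_subset[OF nbhd_subset] .

lemma is_clique_subset: "is_clique E K \<Longrightarrow> L \<subseteq> K \<Longrightarrow> is_clique E L"
  unfolding is_clique_def by blast

lemma is_clique_closed_nbhd: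
  assumes "symp E" "is_clique E (nbhd T E u)"
  shows "is_clique E (closed_nbhd T E u)"
  using assms unfolding is_clique_def closed_nbhd_def nbhd_def by (auto dest: sympD)

lemma card_closed_nbhd:
  assumes "finite T" "irreflp E"
  shows "card (closed_nbhd T E u) = Suc (card (nbhd T E u))"
  using assms unfolding closed_nbhd_def nbhd_def by (simp add: irreflpD)

lemma colourable_mono: "colourable E T k \<Longrightarrow> k \<le> l \<Longrightarrow> colourable E T l"
  unfolding colourable_def proper_colouring_def by (metis order_less_le_trans)

lemma inj_on_clique:
  assumes "proper_colouring E T k c" "K \<subseteq> T" "is_clique E K"
  shows "inj_on c K"
  using assms unfolding inj_on_def is_clique_def proper_colouring_def by (meson subsetD)

lemma card_clique_le_clique_number:
  assumes "finite T" "K \<subseteq> T" "is_clique E K"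
  shows "card K \<le> clique_number E T"
  unfolding clique_number_def using assms by (intro Max_ge) auto

lemma clique_number_attained:
  assumes "finite T"
  obtains K where "K \<subseteq> T" "is_clique E K" "card K = clique_number E T"
proof -
  have "is_clique E {}" by (simp add: is_clique_def)
  then have "clique_number E T \<in> card ` {K. K \<subseteq> T \<and> is_clique E K}"
    unfolding clique_number_def using assms by (intro Max_in) auto
  then show thesis using that by auto
qed

lemma clique_number_mono:
  assumes "finite T" "U \<subseteq> T"
  shows "clique_number E U \<le> clique_number E T"
proof -
  obtain K where "K \<subseteq> U" "is_clique E K" "card K = clique_number E U"
    using clique_number_attained finite_subset[OF assms(2,1)] by metis
  then show ?thesis using card_clique_le_clique_number[of T K E] assms by auto
qed

lemma clique_number_le_colours:
  assumes "finite T" "colourable E T k"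
  shows "clique_number E T \<le> k"
proof -
  obtain c where c: "proper_colouring E T k c" using assms(2) unfolding colourable_def by blast
  obtain K where K: "K \<subseteq> T" "is_clique E K" "card K = clique_number E T"
    using clique_number_attained[OF assms(1)] by metis
  have "c ` K \<subseteq> {..<k}" using K(1) c by (auto simp: proper_colouring_def)
  then have "card K \<le> card {..<k}" by (rule card_inj_on_le[OF inj_on_clique[OF c K(1,2)]]) simp
  then show ?thesis using K(3) by simp
qed

lemma perfect_onI:
  assumes "finite S"
    and colourable_step: "\<And>T. T \<subseteq> S \<Longrightarrow> T \<noteq> {} \<Longrightarrow>
      (\<And>u. u \<in> T \<Longrightarrow> colourable E (T - {u}) (clique_number E T)) \<Longrightarrow>
      colourable E T (clique_number E T)"
  shows "perfect_on E S"
  unfolding perfect_on_def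
proof (intro allI impI)
  fix T assume "T \<subseteq> S"
  then have "finite T" using \<open>finite S\<close> finite_subset by blast
  then have "colourable E T (clique_number E T)" using \<open>T \<subseteq> S\<close>
  proof (induction T rule: finite_psubset_induct)
    case (psubset T)
    show ?case
    proof (cases "T = {}")
      case True
      then show ?thesis by (simp add: colourable_def proper_colouring_def)
    next
      case False
      have "colourable E (T - {u}) (clique_number E T)" if "u \<in> T" for u
      proof (rule colourable_mono)
        show "colourable E (T - {u}) (clique_number E (T - {u}))"
          using psubset.IH psubset.prems that by blast
        show "clique_number E (T - {u}) \<le> clique_number E T"
          using clique_number_mono psubset.hyps by blast
      qed
      with psubset.prems False show ?thesis by (rule colourable_step)
    qed
  qed
  then show "chromatic_number E T = clique_number E T"
    using clique_number_le_colours[OF \<open>finite T\<close>]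
    unfolding chromatic_number_def colourable_def[symmetric] by (intro Least_equality)
qed

lemma colourable_if_colours_outnumber_nbrs:
  assumes "symp E" "irreflp E"
    and c: "proper_colouring E (T - {u}) k c"
    and R: "finite R" "card R < card D" and D: "D \<subseteq> {..<k}"
    and avoids: "\<And>w. w \<in> nbhd T E u \<Longrightarrow> w \<notin> R \<Longrightarrow> c w \<notin> D"
  shows "colourable E T k"
proof -
  have "card (c ` R) < card D" using R card_image_le le_less_trans by blast
  then have "\<not> D \<subseteq> c ` R" using card_mono[of "c ` R" D] R(1) by auto
  then obtain i where i: "i \<in> D" "i \<notin> c ` R" by blast
  then have "c w \<noteq> i" if "w \<in> T" "E u w" for w
    using avoids[of w] that unfolding nbhd_def by auto
  then have "proper_colouring E T k (c(u := i))"
    using c i(1) D sympD[OF \<open>symp E\<close>] irreflpD[OF \<open>irreflp E\<close>]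
    unfolding proper_colouring_def by auto
  then show ?thesis unfolding colourable_def by blast
qed

lemma colourable_if_simplicial_vertex:
  assumes "symp E" "irreflp E" "finite T" "u \<in> T"
    and clique: "is_clique E (nbhd T E u)"
    and colourable: "colourable E (T - {u}) k" and k: "clique_number E T \<le> k"
  shows "colourable E T k"
proof -
  obtain c where c: "proper_colouring E (T - {u}) k c"
    using colourable unfolding colourable_def by blast
  have "card (nbhd T E u) < card (closed_nbhd T E u)"
    using card_closed_nbhd[OF \<open>finite T\<close> \<open>irreflp E\<close>] by simp
  also have "\<dots> \<le> clique_number E T"
    using card_clique_le_clique_number[OF \<open>finite T\<close> _ is_clique_closed_nbhd[OF \<open>symp E\<close> clique]]
      nbhd_subset[of T E u] \<open>u \<in> T\<close> by (simp add: closed_nbhd_def)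
  finally have "card (nbhd T E u) < card {..<k}" using k by simp
  then show ?thesis
    using colourable_if_colours_outnumber_nbrs[OF assms(1,2) c finite_nbhd[OF \<open>finite T\<close>]] by blast
qed

lemma colourable_if_nbhd_complete_to_larger_clique:
  assumes "symp E" "irreflp E"
    and clique: "Q \<subseteq> T - {u}" "is_clique E Q"
    and R: "finite R" "card R < card Q"
    and complete: "\<And>w q. w \<in> nbhd T E u \<Longrightarrow> w \<notin> R \<Longrightarrow> q \<in> Q \<Longrightarrow> E w q"
    and colourable: "colourable E (T - {u}) k"
  shows "colourable E T k"
proof -
  obtain c where c: "proper_colouring E (T - {u}) k c"
    using colourable unfolding colourable_def by blast
  have "card (c ` Q) = card Q" using inj_on_clique[OF c clique] by (rule card_image)
  then have "card R < card (c ` Q)" using R by simp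
  moreover have "c ` Q \<subseteq> {..<k}" using c clique(1) unfolding proper_colouring_def by blast
  moreover have "c w \<notin> c ` Q" if "w \<in> nbhd T E u" "w \<notin> R" for w
  proof -
    have "w \<in> T - {u}" using that \<open>irreflp E\<close> unfolding nbhd_def by (auto dest: irreflpD)
    then show ?thesis using complete[OF that] c clique(1) unfolding proper_colouring_def by blast
  qed
  ultimately show ?thesis by (rule colourable_if_colours_outnumber_nbrs[OF assms(1,2) c R(1)])
qed

section \<open>Fork- and dart-free graphs\<close>

lemma contains_inducedI_less:
  fixes VH :: "'b::linorder set"
  assumes "symp E" "irreflp E" "symp EH" "irreflp EH" and image: "f ` VH \<subseteq> V"
    and pairs: "\<And>x y. x \<in> VH \<Longrightarrow> y \<in> VH \<Longrightarrow> x < y \<Longrightarrow>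
      f x \<noteq> f y \<and> (E (f x) (f y) \<longleftrightarrow> EH x y)"
  shows "contains_induced V E VH EH"
  unfolding contains_induced_def
proof (intro exI[of _ f] conjI ballI)
  show "inj_on f VH" using pairs by (metis inj_onI linorder_less_linear)
  fix x y assume "x \<in> VH" "y \<in> VH"
  then show "E (f x) (f y) \<longleftrightarrow> EH x y"
    using pairs assms(1-4) by (cases x y rule: linorder_cases) (metis sympD irreflpD)+
qed (rule image)

locale fork_dart_free_graph =
  fixes V :: "'a set" and E :: "'a \<Rightarrow> 'a \<Rightarrow> bool"
  assumes simple: "simple_graph V E"
    and fork_free: "\<not> contains_induced V E fork_verts fork_edges"
    and dart_free: "\<not> contains_induced V E dart_verts dart_edges"
begin

lemma finite_V: "finite V"
  and edge_in_V: "E x y \<Longrightarrow> x \<in> V \<and> y \<in> V"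
  and symp_E: "symp E"
  and irreflp_E: "irreflp E"
  using simple by (auto simp: simple_graph_def symp_def irreflp_def)

lemmas edge_sym = sympD[OF symp_E] and edge_irrefl = irreflpD[OF irreflp_E]

lemma finite_subset_nonnbhd: "T \<subseteq> nonnbhd V E v \<Longrightarrow> finite T"
  using finite_V finite_subset unfolding nonnbhd_def by blast

lemma no_induced_fork:
  assumes "E p q" "E p r" "E p s" "E s t" "q \<noteq> r"
    and "\<not> E q r" "\<not> E q s" "\<not> E r s" "\<not> E p t" "\<not> E q t" "\<not> E r t"
  shows False
proof -
  let ?f = "(\<lambda>_::nat. p)(1 := q, 2 := r, 3 := s, 4 := t)"
  have distinct: "distinct [p, q, r, s, t]"
    using assms edge_irrefl edge_sym by (simp, metis)
  have "contains_induced V E fork_verts fork_edges"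
  proof (rule contains_inducedI_less[OF symp_E irreflp_E, of _ ?f])
    show "symp fork_edges" by (simp add: symp_def fork_edges_def insert_commute)
    show "irreflp fork_edges" by (auto simp: irreflp_def fork_edges_def doubleton_eq_iff)
    show "?f ` fork_verts \<subseteq> V" using assms(1-4) edge_in_V by (auto simp: fork_verts_def)
    show "?f x \<noteq> ?f y \<and> (E (?f x) (?f y) \<longleftrightarrow> fork_edges x y)"
      if "x \<in> fork_verts" "y \<in> fork_verts" "x < y" for x y
      using that assms distinct by (auto simp: fork_verts_def fork_edges_def doubleton_eq_iff)
  qed
  then show False using fork_free by blast
qed

lemma no_induced_dart:
  assumes "E p q" "E p r" "E p s" "E p t" "E r t" "E s t" "r \<noteq> s"
    and "\<not> E q r" "\<not> E q s" "\<not> E r s" "\<not> E q t"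
  shows False
proof -
  let ?f = "(\<lambda>_::nat. p)(2 := q, 3 := r, 4 := s, 5 := t)"
  have distinct: "distinct [p, q, r, s, t]"
    using assms edge_irrefl edge_sym by (simp, metis)
  have "contains_induced V E dart_verts dart_edges"
  proof (rule contains_inducedI_less[OF symp_E irreflp_E, of _ ?f])
    show "symp dart_edges" by (simp add: symp_def dart_edges_def insert_commute)
    show "irreflp dart_edges" by (auto simp: irreflp_def dart_edges_def doubleton_eq_iff)
    show "?f ` dart_verts \<subseteq> V" using assms(1-6) edge_in_V by (auto simp: dart_verts_def)
    show "?f x \<noteq> ?f y \<and> (E (?f x) (?f y) \<longleftrightarrow> dart_edges x y)"
      if "x \<in> dart_verts" "y \<in> dart_verts" "x < y" for x y
      using that assms distinct by (auto simp: dart_verts_def dart_edges_def doubleton_eq_iff)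
  qed
  then show False using dart_free by blast
qed

lemma is_clique_nbhd_within_nbhd:
  assumes "E v x" "T \<subseteq> nonnbhd V E v" "s \<in> nbhd T E x"
  shows "is_clique E (nbhd (nbhd T E x) E s)"
  unfolding is_clique_def
proof (intro ballI impI)
  fix r t assume rt: "r \<in> nbhd (nbhd T E x) E s" "t \<in> nbhd (nbhd T E x) E s" "r \<noteq> t"
  then have "\<not> E v r" "\<not> E v s" "\<not> E v t" "E x r" "E x s" "E x t" "E s r" "E s t"
    using assms unfolding nonnbhd_def nbhd_def by auto
  then show "E r t" using no_induced_dart[of x v r t s] assms(1) rt(3) edge_sym by blast
qed

lemma adjacent_to_nonadjacent_nbrs:
  assumes "E v x" "r \<in> nbhd (nonnbhd V E v) E x" "s \<in> nbhd (nonnbhd V E v) E x"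
    and "\<not> E r s" "z \<in> nonnbhd V E v" "\<not> E x z" "E r z"
  shows "E s z"
proof (rule ccontr)
  assume "\<not> E s z"
  moreover have "\<not> E v r" "\<not> E v s" "v \<noteq> s" "\<not> E v z" "E x r" "E x s"
    using assms(2,3,5) unfolding nonnbhd_def nbhd_def by auto
  moreover have "E x v" "\<not> E s r" using assms(1,4) edge_sym by auto
  ultimately show False using no_induced_fork[of x v s r z] assms(6,7) by blast
qed

lemma colourable_if_nonadjacent_nbrs_degree_le:
  assumes T: "T \<subseteq> nonnbhd V E v" and x: "E v x"
    and p: "p \<in> nbhd T E x" and q: "q \<in> nbhd T E x" and "p \<noteq> q" "\<not> E p q"
    and le: "card (nbhd (nbhd T E x) E p) \<le> card (nbhd (nbhd T E x) E q)"
    and colourable: "colourable E (T - {p}) k"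
  shows "colourable E T k"
proof -
  let ?R = "nbhd (nbhd T E x) E p" and ?Q = "closed_nbhd (nbhd T E x) E q"
  have finite_nbhd_x: "finite (nbhd T E x)"
    using finite_subset_nonnbhd[OF T] by (rule finite_nbhd)
  then have finite_R: "finite ?R" by (rule finite_nbhd)
  have card_less: "card ?R < card ?Q"
    using le card_closed_nbhd[OF finite_nbhd_x irreflp_E] by simp
  have clique_Q: "is_clique E ?Q"
    using is_clique_closed_nbhd[OF symp_E is_clique_nbhd_within_nbhd[OF x T q]] .
  have in_Q: "s \<in> nbhd T E x \<and> s \<noteq> p \<and> \<not> E p s" if "s \<in> ?Q" for s
  proof (cases "s = q")
    case False
    then have s: "s \<in> nbhd T E x" "E s q"
      using that edge_sym unfolding closed_nbhd_def nbhd_def by auto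
    then have "\<not> E p s"
      using is_clique_nbhd_within_nbhd[OF x T s(1)] p q \<open>p \<noteq> q\<close> \<open>\<not> E p q\<close> edge_sym
      unfolding is_clique_def nbhd_def by blast
    then show ?thesis using s \<open>\<not> E p q\<close> by blast
  qed (use q \<open>p \<noteq> q\<close> \<open>\<not> E p q\<close> in blast)
  then have "?Q \<subseteq> T - {p}" using nbhd_subset by fast
  moreover have "E w s" if "w \<in> nbhd T E p" "w \<notin> ?R" "s \<in> ?Q" for w s
  proof -
    have "w \<in> nonnbhd V E v" "\<not> E x w" "E p w" using that(1,2) T unfolding nbhd_def by auto
    moreover have "p \<in> nbhd (nonnbhd V E v) E x" "s \<in> nbhd (nonnbhd V E v) E x"
      using in_Q[OF that(3)] p T unfolding nbhd_def by auto
    ultimately show ?thesis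
      using adjacent_to_nonadjacent_nbrs[OF x, of p s w] in_Q[OF that(3)] edge_sym by blast
  qed
  ultimately show ?thesis
    using colourable_if_nbhd_complete_to_larger_clique[OF symp_E irreflp_E _ clique_Q finite_R
        card_less _ colourable] by blast
qed

lemma colourable_if_nbhd_not_clique:
  assumes "T \<subseteq> nonnbhd V E v" "E v x" "\<not> is_clique E (nbhd T E x)"
    and "\<And>u. u \<in> T \<Longrightarrow> colourable E (T - {u}) k"
  shows "colourable E T k"
proof -
  obtain p q where pq: "p \<in> nbhd T E x" "q \<in> nbhd T E x" "p \<noteq> q" "\<not> E p q"
    using assms(3) unfolding is_clique_def by blast
  then have in_T: "p \<in> T" "q \<in> T" unfolding nbhd_def by auto
  consider (p_le_q) "card (nbhd (nbhd T E x) E p) \<le> card (nbhd (nbhd T E x) E q)"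
    | (q_le_p) "card (nbhd (nbhd T E x) E q) \<le> card (nbhd (nbhd T E x) E p)"
    by linarith
  then show ?thesis
  proof cases
    case p_le_q
    then show ?thesis
      using colourable_if_nonadjacent_nbrs_degree_le[OF assms(1,2)] pq in_T assms(4) by blast
  next
    case q_le_p
    then show ?thesis
      using colourable_if_nonadjacent_nbrs_degree_le[OF assms(1,2)] pq in_T assms(4) edge_sym by metis
  qed
qed

end

section \<open>The non-neighbours of the center of a claw\<close>

locale claw_in_fork_dart_free_graph = fork_dart_free_graph +
  fixes v :: 'a and A :: "'a set"
  assumes leaves_subset: "A \<subseteq> nbhd V E v"
    and leaves_stable: "p \<in> A \<Longrightarrow> q \<in> A \<Longrightarrow> \<not> E p q"
    and three_leaves: "3 \<le> card A"
begin

abbreviation M :: "'a set" where "M \<equiv> nonnbhd V E v"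

definition second_nbhd :: "'a set" where
  "second_nbhd = {y \<in> M. \<exists>x. E v x \<and> E x y}"

definition far :: "'a set" where
  "far = M - second_nbhd"

lemma M_iff: "y \<in> M \<longleftrightarrow> y \<in> V \<and> \<not> E v y \<and> y \<noteq> v"
  by (auto simp: nonnbhd_def nbhd_def)

lemma leaf_adjacent: "p \<in> A \<Longrightarrow> E v p"
  using leaves_subset unfolding nbhd_def by blast

lemma third_leaf:
  obtains r where "r \<in> A" "r \<noteq> p" "r \<noteq> q"
proof -
  have "card {p, q} < card A" using three_leaves card_insert_le_m1[of 2 "{q}" p] by simp
  then have "\<not> A \<subseteq> {p, q}" using card_mono[of "{p, q}" A] by auto
  then show thesis using that by blast
qed

lemma two_leaves_agree:
  obtains p q where "p \<in> A" "q \<in> A" "p \<noteq> q" "P p \<longleftrightarrow> P q"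
proof -
  obtain a where "a \<in> A" using third_leaf by blast
  moreover obtain b where "b \<in> A" "b \<noteq> a" using third_leaf by blast
  moreover obtain c where "c \<in> A" "c \<noteq> a" "c \<noteq> b" using third_leaf by blast
  ultimately show thesis using that by metis
qed

lemma second_nbhd_has_leaf_nbr:
  assumes "y \<in> second_nbhd"
  shows "\<exists>p\<in>A. E p y"
proof (rule ccontr)
  assume no_leaf_nbr: "\<not> (\<exists>p\<in>A. E p y)"
  obtain x where x: "E v x" "E x y" and y: "\<not> E v y"
    using assms unfolding second_nbhd_def M_iff by blast
  obtain p q where pq: "p \<in> A" "q \<in> A" "p \<noteq> q" "E x p \<longleftrightarrow> E x q"
    by (rule two_leaves_agree[of "E x"])
  then have leaves: "E v p" "E v q" "\<not> E p q" using leaf_adjacent leaves_stable by auto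
  show False
  proof (cases "E x p")
    case True
    then show False
      using no_induced_dart[of x y p q v] x y pq leaves no_leaf_nbr edge_sym by blast
  next
    case False
    then show False
      using no_induced_fork[of v p q x y] x y pq leaves no_leaf_nbr edge_sym by blast
  qed
qed

lemma second_nbhd_misses_at_most_one_leaf:
  assumes y: "y \<in> second_nbhd"
  obtains p where "\<And>r. r \<in> A \<Longrightarrow> r \<noteq> p \<Longrightarrow> E r y"
proof -
  obtain s where s: "s \<in> A" "E s y" using second_nbhd_has_leaf_nbr[OF y] by blast
  have "\<not> E v y" using y unfolding second_nbhd_def M_iff by blast
  then have "p = r" if "p \<in> A" "r \<in> A" "\<not> E p y" "\<not> E r y" for p r
    using no_induced_fork[of v p r s y] that s leaf_adjacent leaves_stable by blast
  then show thesis using that by metis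
qed

lemma second_nbhd_common_leaf_nbr:
  assumes "y \<in> second_nbhd" "z \<in> second_nbhd"
  obtains r where "r \<in> A" "E r y" "E r z"
proof -
  obtain p where "\<And>r. r \<in> A \<Longrightarrow> r \<noteq> p \<Longrightarrow> E r y"
    using second_nbhd_misses_at_most_one_leaf[OF assms(1)] by blast
  moreover obtain q where "\<And>r. r \<in> A \<Longrightarrow> r \<noteq> q \<Longrightarrow> E r z"
    using second_nbhd_misses_at_most_one_leaf[OF assms(2)] by blast
  moreover obtain r where "r \<in> A" "r \<noteq> p" "r \<noteq> q" using third_leaf .
  ultimately show thesis using that by blast
qed

lemma second_nbhd_two_leaf_nbrs:
  assumes "y \<in> second_nbhd"
  obtains p q where "p \<in> A" "q \<in> A" "p \<noteq> q" "E p y" "E q y"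
proof -
  obtain m where "\<And>r. r \<in> A \<Longrightarrow> r \<noteq> m \<Longrightarrow> E r y"
    using second_nbhd_misses_at_most_one_leaf[OF assms] by blast
  moreover obtain p where "p \<in> A" "p \<noteq> m" using third_leaf by blast
  moreover obtain q where "q \<in> A" "q \<noteq> m" "q \<noteq> p" using third_leaf .
  ultimately show thesis using that by blast
qed

lemma far_nonadjacent_nbhd: "z \<in> far \<Longrightarrow> E v x \<Longrightarrow> \<not> E x z"
  unfolding far_def second_nbhd_def by blast

lemma second_nbhd_complete_to_far_edge:
  assumes "y \<in> second_nbhd" "z \<in> far" "w \<in> far" "E y z" "E z w"
  shows "E y w"
proof (rule ccontr)
  assume "\<not> E y w"
  obtain p q where pq: "p \<in> A" "q \<in> A" "p \<noteq> q" "E p y" "E q y"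
    using second_nbhd_two_leaf_nbrs[OF assms(1)] .
  then have "\<not> E p q" "\<not> E p z" "\<not> E q z" "\<not> E p w" "\<not> E q w"
    using leaves_stable leaf_adjacent far_nonadjacent_nbhd assms(2,3) by auto
  then show False
    using no_induced_fork[of y p q z w] pq assms(4,5) \<open>\<not> E y w\<close> edge_sym by blast
qed

lemma far_has_second_nbhd_nbr:
  assumes connected: "connected_graph V E" and z: "z \<in> far"
  obtains y where "y \<in> second_nbhd" "E y z"
proof -
  have "v \<in> V" using third_leaf leaf_adjacent edge_in_V by metis
  moreover have "z \<in> V" using z by (simp add: far_def M_iff)
  ultimately have "(\<lambda>a b. E a b \<and> a \<in> V \<and> b \<in> V)\<^sup>*\<^sup>* v z"
    using connected unfolding connected_graph_def by blast
  then have "z \<in> far \<longrightarrow> (\<exists>y\<in>second_nbhd. E y z)"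
  proof induction
    case base
    then show ?case by (simp add: far_def M_iff)
  next
    case (step t w)
    show ?case
    proof
      assume w: "w \<in> far"
      have "t \<noteq> v" using w step.hyps(2) by (auto simp: far_def M_iff)
      then have "t \<in> far \<or> t \<in> second_nbhd"
        using far_nonadjacent_nbhd[OF w] step.hyps(2) by (auto simp: far_def M_iff)
      then show "\<exists>y\<in>second_nbhd. E y w"
        using step w second_nbhd_complete_to_far_edge by blast
    qed
  qed
  then show thesis using z that by blast
qed

lemma is_clique_far_nbhd:
  assumes "connected_graph V E" "z \<in> far"
  shows "is_clique E (nbhd far E z)"
  unfolding is_clique_def
proof (intro ballI impI)
  fix w t assume wt: "w \<in> nbhd far E z" "t \<in> nbhd far E z" "w \<noteq> t"
  then have far: "w \<in> far" "t \<in> far" "E z w" "E z t" unfolding nbhd_def by auto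
  obtain y where y: "y \<in> second_nbhd" "E y z" using far_has_second_nbhd_nbr[OF assms] .
  have complete: "E y w" "E y t"
    using second_nbhd_complete_to_far_edge[OF y(1) assms(2)] far y(2) by auto
  obtain p where p: "p \<in> A" "E p y" using second_nbhd_has_leaf_nbr[OF y(1)] by blast
  then have "\<not> E p z" "\<not> E p w" "\<not> E p t"
    using far_nonadjacent_nbhd[OF _ leaf_adjacent[OF p(1)]] assms(2) far by auto
  then show "E w t"
    using no_induced_dart[of y p w t z] complete y(2) p(2) far wt(3) edge_sym by blast
qed

lemma is_clique_Int_second_nbhd:
  assumes "\<And>x. E v x \<Longrightarrow> is_clique E (nbhd T E x)"
  shows "is_clique E (T \<inter> second_nbhd)"
  unfolding is_clique_def
proof (intro ballI impI)
  fix y z assume yz: "y \<in> T \<inter> second_nbhd" "z \<in> T \<inter> second_nbhd" "y \<noteq> z"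
  then obtain r where "r \<in> A" "E r y" "E r z" using second_nbhd_common_leaf_nbr by blast
  then show "E y z" using assms[OF leaf_adjacent] yz unfolding is_clique_def nbhd_def by blast
qed

lemma is_clique_nbhd_of_far_vertex:
  assumes connected: "connected_graph V E" and T: "T \<subseteq> M" and far: "u \<in> far"
    and cliques: "\<And>x. E v x \<Longrightarrow> is_clique E (nbhd T E x)"
  shows "is_clique E (nbhd T E u)"
  unfolding is_clique_def
proof (intro ballI impI)
  fix w t assume wt: "w \<in> nbhd T E u" "t \<in> nbhd T E u" "w \<noteq> t"
  then have nbrs: "w \<in> T" "t \<in> T" "E u w" "E u t" unfolding nbhd_def by auto
  then consider (both_second) "w \<in> second_nbhd" "t \<in> second_nbhd"
    | (second_far) "w \<in> second_nbhd" "t \<in> far"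
    | (far_second) "w \<in> far" "t \<in> second_nbhd"
    | (both_far) "w \<in> far" "t \<in> far"
    using T unfolding far_def by blast
  then show "E w t"
  proof cases
    case both_second
    then show ?thesis
      using is_clique_Int_second_nbhd[OF cliques] nbrs wt(3) unfolding is_clique_def by blast
  next
    case second_far
    then show ?thesis using second_nbhd_complete_to_far_edge far nbrs edge_sym by blast
  next
    case far_second
    then show ?thesis using second_nbhd_complete_to_far_edge far nbrs edge_sym by blast
  next
    case both_far
    then show ?thesis
      using is_clique_far_nbhd[OF connected far] nbrs wt(3) unfolding is_clique_def nbhd_def by blast
  qed
qed

lemma simplicial_vertex_exists:
  assumes "connected_graph V E" "T \<subseteq> M" "T \<noteq> {}"
    and cliques: "\<And>x. E v x \<Longrightarrow> is_clique E (nbhd T E x)"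
  shows "\<exists>u\<in>T. is_clique E (nbhd T E u)"
proof (cases "T \<inter> far = {}")
  case True
  then have "nbhd T E u \<subseteq> T \<inter> second_nbhd" for u
    using \<open>T \<subseteq> M\<close> unfolding far_def nbhd_def by blast
  then show ?thesis
    using is_clique_subset[OF is_clique_Int_second_nbhd[OF cliques]] \<open>T \<noteq> {}\<close> by blast
next
  case False
  then show ?thesis using is_clique_nbhd_of_far_vertex[OF assms(1,2) _ cliques] by blast
qed

lemma perfect_on_nonnbhd:
  assumes connected: "connected_graph V E"
  shows "perfect_on E M"
proof (rule perfect_onI)
  show "finite M" using finite_V by (simp add: nonnbhd_def)
  fix T
  assume T: "T \<subseteq> M" "T \<noteq> {}"
    and deleted: "\<And>u. u \<in> T \<Longrightarrow> colourable E (T - {u}) (clique_number E T)"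
  show "colourable E T (clique_number E T)"
  proof (cases "\<forall>x. E v x \<longrightarrow> is_clique E (nbhd T E x)")
    case True
    then obtain u where u: "u \<in> T" "is_clique E (nbhd T E u)"
      using simplicial_vertex_exists[OF connected T] by blast
    show ?thesis
      using colourable_if_simplicial_vertex[OF symp_E irreflp_E finite_subset_nonnbhd[OF T(1)] u
          deleted[OF u(1)]] by simp
  next
    case False
    then show ?thesis using colourable_if_nbhd_not_clique[OF T(1)] deleted by blast
  qed
qed

end

theorem theorem3p5:
  fixes V :: "'a set" and E :: "'a \<Rightarrow> 'a \<Rightarrow> bool" and v :: 'a
  assumes "simple_graph V E"
    and "connected_graph V E"
    and "\<not> contains_induced V E fork_verts fork_edges"
    and "\<not> contains_induced V E dart_verts dart_edges"
    and "claw_center V E v"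
  shows "perfect_on E (nonnbhd V E v)"
proof -
  interpret fork_dart_free_graph V E using assms by unfold_locales
  obtain a b c where "{a, b, c} \<subseteq> nbhd V E v" "a \<noteq> b" "a \<noteq> c" "b \<noteq> c"
    "\<not> E a b" "\<not> E a c" "\<not> E b c"
    using assms(5) unfolding claw_center_def by blast
  then interpret claw_in_fork_dart_free_graph V E v "{a, b, c}"
    using edge_sym edge_irrefl by unfold_locales auto
  show ?thesis using assms(2) by (rule perfect_on_nonnbhd)
qed

end
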